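(* The variety of semilinear idempotent residuated lattices is not locally finite.
   Context: A residuated lattice is an algebra $\mathbf A=\langle A,\wedge,\vee,\cdot,\backslash,/,\mathrm e\rangle$ such that $\langle A,\wedge,\vee\rangle$ is a lattice, $\langle A,\cdot,\mathrm e\rangle$ is a monoid, and for all $a,b,c\in A$: $b\le a\backslash c\iff a\cdot b\le c\iff a\le c/b$. It is idempotent if $aa=a$ for all $a$. The variety of semilinear idempotent residuated lattices is the variety generated by all totally ordered idempotent residuated lattices. A variety is locally finite if each of its finitely generated members is finite. *)

theory Defs
  imports "HOL-Algebra.Group" "HOL-Library.Countable_Set"
begin

text \<open>
  Algebras of the signature of residuated lattices, with an explicit carrier.
  The monoid part (carrier, \<open>\<otimes>\<close>, \<open>\<one>\<close>) is the record of \<^theory>\<open>HOL-Algebra.Group\<close>;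
  \<open>a \<setminus> b\<close> is the left division \<open>a\b\<close> and \<open>a \<oslash> b\<close> is the right division \<open>a/b\<close>.
\<close>

record 'a rl = "'a monoid" +
  rl_meet :: "['a, 'a] \<Rightarrow> 'a" (infixl "\<^bold>\<and>\<index>" 65)
  rl_join :: "['a, 'a] \<Rightarrow> 'a" (infixl "\<^bold>\<or>\<index>" 65)
  rl_ldiv :: "['a, 'a] \<Rightarrow> 'a" (infixl "\<setminus>\<index>" 67)
  rl_rdiv :: "['a, 'a] \<Rightarrow> 'a" (infixl "\<oslash>\<index>" 67)

definition rl_le :: "'a rl \<Rightarrow> 'a \<Rightarrow> 'a \<Rightarrow> bool" where
  "rl_le A a b \<longleftrightarrow> a \<^bold>\<and>\<^bsub>A\<^esub> b = a"

definition rl_subuniverse :: "'a rl \<Rightarrow> 'a set \<Rightarrow> bool" where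
  "rl_subuniverse A S \<longleftrightarrow> S \<subseteq> carrier A \<and> \<one>\<^bsub>A\<^esub> \<in> S \<and>
     (\<forall>a\<in>S. \<forall>b\<in>S. a \<otimes>\<^bsub>A\<^esub> b \<in> S \<and> a \<^bold>\<and>\<^bsub>A\<^esub> b \<in> S \<and> a \<^bold>\<or>\<^bsub>A\<^esub> b \<in> S \<and>
        a \<setminus>\<^bsub>A\<^esub> b \<in> S \<and> a \<oslash>\<^bsub>A\<^esub> b \<in> S)"

definition rl_algebra :: "'a rl \<Rightarrow> bool" where
  "rl_algebra A \<longleftrightarrow> rl_subuniverse A (carrier A)"

locale residuated_lattice = monoid A for A :: "'a rl" (structure) +
  assumes algebra: "rl_algebra A"
    and meet_assoc: "\<lbrakk>a \<in> carrier A; b \<in> carrier A; c \<in> carrier A\<rbrakk> \<Longrightarrow> (a \<^bold>\<and> b) \<^bold>\<and> c = a \<^bold>\<and> (b \<^bold>\<and> c)"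
    and join_assoc: "\<lbrakk>a \<in> carrier A; b \<in> carrier A; c \<in> carrier A\<rbrakk> \<Longrightarrow> (a \<^bold>\<or> b) \<^bold>\<or> c = a \<^bold>\<or> (b \<^bold>\<or> c)"
    and meet_comm: "\<lbrakk>a \<in> carrier A; b \<in> carrier A\<rbrakk> \<Longrightarrow> a \<^bold>\<and> b = b \<^bold>\<and> a"
    and join_comm: "\<lbrakk>a \<in> carrier A; b \<in> carrier A\<rbrakk> \<Longrightarrow> a \<^bold>\<or> b = b \<^bold>\<or> a"
    and meet_absorb: "\<lbrakk>a \<in> carrier A; b \<in> carrier A\<rbrakk> \<Longrightarrow> a \<^bold>\<and> (a \<^bold>\<or> b) = a"
    and join_absorb: "\<lbrakk>a \<in> carrier A; b \<in> carrier A\<rbrakk> \<Longrightarrow> a \<^bold>\<or> (a \<^bold>\<and> b) = a"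
    and ldiv_residual: "\<lbrakk>a \<in> carrier A; b \<in> carrier A; c \<in> carrier A\<rbrakk>
          \<Longrightarrow> rl_le A b (a \<setminus> c) \<longleftrightarrow> rl_le A (a \<otimes> b) c"
    and rdiv_residual: "\<lbrakk>a \<in> carrier A; b \<in> carrier A; c \<in> carrier A\<rbrakk>
          \<Longrightarrow> rl_le A (a \<otimes> b) c \<longleftrightarrow> rl_le A a (c \<oslash> b)"

definition rl_idempotent :: "'a rl \<Rightarrow> bool" where
  "rl_idempotent A \<longleftrightarrow> (\<forall>a\<in>carrier A. a \<otimes>\<^bsub>A\<^esub> a = a)"

definition rl_totally_ordered :: "'a rl \<Rightarrow> bool" where
  "rl_totally_ordered A \<longleftrightarrow> (\<forall>a\<in>carrier A. \<forall>b\<in>carrier A. rl_le A a b \<or> rl_le A b a)"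

datatype rl_term =
    Var nat
  | Unit
  | Mult rl_term rl_term
  | Meet rl_term rl_term
  | Join rl_term rl_term
  | LDiv rl_term rl_term
  | RDiv rl_term rl_term

instance rl_term :: countable
  by countable_datatype

primrec rl_eval :: "'a rl \<Rightarrow> (nat \<Rightarrow> 'a) \<Rightarrow> rl_term \<Rightarrow> 'a" where
  "rl_eval A v (Var n) = v n"
| "rl_eval A v Unit = \<one>\<^bsub>A\<^esub>"
| "rl_eval A v (Mult s t) = rl_eval A v s \<otimes>\<^bsub>A\<^esub> rl_eval A v t"
| "rl_eval A v (Meet s t) = rl_eval A v s \<^bold>\<and>\<^bsub>A\<^esub> rl_eval A v t"
| "rl_eval A v (Join s t) = rl_eval A v s \<^bold>\<or>\<^bsub>A\<^esub> rl_eval A v t"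
| "rl_eval A v (LDiv s t) = rl_eval A v s \<setminus>\<^bsub>A\<^esub> rl_eval A v t"
| "rl_eval A v (RDiv s t) = rl_eval A v s \<oslash>\<^bsub>A\<^esub> rl_eval A v t"

definition rl_satisfies :: "'a rl \<Rightarrow> rl_term \<times> rl_term \<Rightarrow> bool" where
  "rl_satisfies A p \<longleftrightarrow>
     (\<forall>v. range v \<subseteq> carrier A \<longrightarrow> rl_eval A v (fst p) = rl_eval A v (snd p))"

text \<open>
  A class of algebras is a set of type \<^typ>\<open>'a rl set\<close>: all carriers are subsets of the
  type \<^typ>\<open>'a\<close>, which plays the role of the universe.  A variety is an equational class.
\<close>

definition rl_models :: "(rl_term \<times> rl_term) set \<Rightarrow> 'a rl set" where
  "rl_models E = {A. rl_algebra A \<and> (\<forall>p\<in>E. rl_satisfies A p)}"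

definition rl_variety :: "'a rl set \<Rightarrow> bool" where
  "rl_variety V \<longleftrightarrow> (\<exists>E. V = rl_models E)"

definition variety_generated_by :: "'a rl set \<Rightarrow> 'a rl set" where
  "variety_generated_by K = \<Inter>{V. rl_variety V \<and> K \<subseteq> V}"

definition idempotent_chains :: "'a rl set" where
  "idempotent_chains = {A. residuated_lattice A \<and> rl_idempotent A \<and> rl_totally_ordered A}"

definition semilinear_idempotent_rl :: "'a rl set" where
  "semilinear_idempotent_rl = variety_generated_by idempotent_chains"

definition rl_generated :: "'a rl \<Rightarrow> 'a set \<Rightarrow> 'a set" where
  "rl_generated A X = \<Inter>{S. rl_subuniverse A S \<and> X \<subseteq> S}"

definition rl_finitely_generated :: "'a rl \<Rightarrow> bool" where
  "rl_finitely_generated A \<longleftrightarrow>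
     (\<exists>X. finite X \<and> X \<subseteq> carrier A \<and> rl_generated A X = carrier A)"

definition locally_finite :: "'a rl set \<Rightarrow> bool" where
  "locally_finite V \<longleftrightarrow> (\<forall>A\<in>V. rl_finitely_generated A \<longrightarrow> finite (carrier A))"

lemma rl_variety_rl_models: "rl_variety (rl_models E)"
  by (auto simp: rl_variety_def)

lemma variety_generated_by_eq:
  assumes "\<And>A. A \<in> K \<Longrightarrow> rl_algebra A"
  shows "variety_generated_by K = rl_models {p. \<forall>A\<in>K. rl_satisfies A p}"
proof
  have "K \<subseteq> rl_models {p. \<forall>A\<in>K. rl_satisfies A p}"
    using assms by (auto simp: rl_models_def)
  then show "variety_generated_by K \<subseteq> rl_models {p. \<forall>A\<in>K. rl_satisfies A p}"
    by (auto simp: variety_generated_by_def rl_variety_rl_models)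
  show "rl_models {p. \<forall>A\<in>K. rl_satisfies A p} \<subseteq> variety_generated_by K"
    by (fastforce simp: variety_generated_by_def rl_variety_def rl_models_def)
qed

lemma semilinear_idempotent_rl_eq:
  "(semilinear_idempotent_rl :: 'a rl set) =
     rl_models {p. \<forall>A\<in>(idempotent_chains :: 'a rl set). rl_satisfies A p}"
  unfolding semilinear_idempotent_rl_def
  by (rule variety_generated_by_eq) (simp add: idempotent_chains_def residuated_lattice.algebra)

lemma rl_algebra_closed:
  assumes "rl_algebra A" "a \<in> carrier A" "b \<in> carrier A"
  shows "a \<otimes>\<^bsub>A\<^esub> b \<in> carrier A" "a \<^bold>\<and>\<^bsub>A\<^esub> b \<in> carrier A" "a \<^bold>\<or>\<^bsub>A\<^esub> b \<in> carrier A"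
    "a \<setminus>\<^bsub>A\<^esub> b \<in> carrier A" "a \<oslash>\<^bsub>A\<^esub> b \<in> carrier A"
  using assms by (auto simp: rl_algebra_def rl_subuniverse_def)

context residuated_lattice
begin

lemmas cl = rl_algebra_closed[OF algebra]

lemma le_join_iff: "\<lbrakk>a \<in> carrier A; b \<in> carrier A\<rbrakk> \<Longrightarrow> rl_le A a b \<longleftrightarrow> a \<^bold>\<or> b = b"
  unfolding rl_le_def by (metis join_absorb join_comm meet_absorb meet_comm)

lemma le_refl: "a \<in> carrier A \<Longrightarrow> rl_le A a a"
  unfolding rl_le_def by (metis cl(2) join_absorb meet_absorb)

lemma le_trans:
  "\<lbrakk>rl_le A a b; rl_le A b c; a \<in> carrier A; b \<in> carrier A; c \<in> carrier A\<rbrakk> \<Longrightarrow> rl_le A a c"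
  unfolding rl_le_def by (metis meet_assoc)

lemma le_antisym: "\<lbrakk>rl_le A a b; rl_le A b a; a \<in> carrier A; b \<in> carrier A\<rbrakk> \<Longrightarrow> a = b"
  unfolding rl_le_def by (metis meet_comm)

lemma le_join1: "\<lbrakk>a \<in> carrier A; b \<in> carrier A\<rbrakk> \<Longrightarrow> rl_le A a (a \<^bold>\<or> b)"
  by (simp add: rl_le_def meet_absorb)

lemma le_join2: "\<lbrakk>a \<in> carrier A; b \<in> carrier A\<rbrakk> \<Longrightarrow> rl_le A b (a \<^bold>\<or> b)"
  by (metis le_join1 join_comm)

lemma join_least:
  "\<lbrakk>rl_le A a c; rl_le A b c; a \<in> carrier A; b \<in> carrier A; c \<in> carrier A\<rbrakk> \<Longrightarrow> rl_le A (a \<^bold>\<or> b) c"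
  by (metis le_join_iff join_assoc cl(3))

lemma mult_join:
  assumes "a \<in> carrier A" "b \<in> carrier A" "c \<in> carrier A"
  shows "rl_le A (a \<otimes> b) (a \<otimes> (b \<^bold>\<or> c))" "rl_le A (b \<otimes> a) ((b \<^bold>\<or> c) \<otimes> a)"
proof -
  have "rl_le A (b \<^bold>\<or> c) (a \<setminus> (a \<otimes> (b \<^bold>\<or> c)))"
    using assms by (simp add: ldiv_residual cl le_refl)
  then have "rl_le A b (a \<setminus> (a \<otimes> (b \<^bold>\<or> c)))"
    using assms le_join1 le_trans cl by meson
  then show "rl_le A (a \<otimes> b) (a \<otimes> (b \<^bold>\<or> c))"
    using assms by (simp add: ldiv_residual cl)
  have "rl_le A (b \<^bold>\<or> c) (((b \<^bold>\<or> c) \<otimes> a) \<oslash> a)"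
    using assms by (simp add: rdiv_residual[symmetric] cl le_refl)
  then have "rl_le A b (((b \<^bold>\<or> c) \<otimes> a) \<oslash> a)"
    using assms le_join1 le_trans cl by meson
  then show "rl_le A (b \<otimes> a) ((b \<^bold>\<or> c) \<otimes> a)"
    using assms by (simp add: rdiv_residual cl)
qed

end

text \<open>Residuation is equational, so the generated variety consists of residuated lattices.\<close>

lemma semilinear_idempotent_rl_residuated:
  fixes A :: "'a rl"
  assumes "A \<in> semilinear_idempotent_rl"
  shows "residuated_lattice A \<and> rl_idempotent A"
proof -
  have alg: "rl_algebra A"
    using assms by (simp add: semilinear_idempotent_rl_eq rl_models_def)
  note cl = rl_algebra_closed[OF alg]
  have oneA: "\<one>\<^bsub>A\<^esub> \<in> carrier A"
    using alg by (simp add: rl_algebra_def rl_subuniverse_def)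
  have eqn: "rl_eval A v s = rl_eval A v t"
    if "range v \<subseteq> carrier A"
      and "\<And>(B :: 'a rl) v. \<lbrakk>B \<in> idempotent_chains; range v \<subseteq> carrier B\<rbrakk> \<Longrightarrow> rl_eval B v s = rl_eval B v t"
    for v s t
    using assms that by (force simp: semilinear_idempotent_rl_eq rl_models_def rl_satisfies_def)
  define val :: "'a \<Rightarrow> 'a \<Rightarrow> 'a \<Rightarrow> nat \<Rightarrow> 'a" where
    "val = (\<lambda>a b c n. if n = 0 then a else if n = 1 then b else c)"
  have val: "range (val a b c) \<subseteq> carrier A"
    if "a \<in> carrier A" "b \<in> carrier A" "c \<in> carrier A" for a b c
    using that by (auto simp: val_def)
  have ch: "residuated_lattice B" "rl_idempotent B" if "B \<in> idempotent_chains" for B :: "'a rl"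
    using that by (auto simp: idempotent_chains_def)
  have rg: "v n \<in> carrier B" if "range v \<subseteq> carrier B" for v n and B :: "'a rl"
    using that by auto
  note rules = eqn[OF val]
  let ?x = "Var 0" and ?y = "Var 1" and ?z = "Var 2"
  note rlB = residuated_lattice.cl[OF ch(1)] residuated_lattice.axioms(1)[OF ch(1)]

  have eqs:
    "(a \<otimes>\<^bsub>A\<^esub> b) \<otimes>\<^bsub>A\<^esub> c = a \<otimes>\<^bsub>A\<^esub> (b \<otimes>\<^bsub>A\<^esub> c)"
    "\<one>\<^bsub>A\<^esub> \<otimes>\<^bsub>A\<^esub> a = a" "a \<otimes>\<^bsub>A\<^esub> \<one>\<^bsub>A\<^esub> = a" "a \<otimes>\<^bsub>A\<^esub> a = a"
    "(a \<^bold>\<and>\<^bsub>A\<^esub> b) \<^bold>\<and>\<^bsub>A\<^esub> c = a \<^bold>\<and>\<^bsub>A\<^esub> (b \<^bold>\<and>\<^bsub>A\<^esub> c)"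
    "(a \<^bold>\<or>\<^bsub>A\<^esub> b) \<^bold>\<or>\<^bsub>A\<^esub> c = a \<^bold>\<or>\<^bsub>A\<^esub> (b \<^bold>\<or>\<^bsub>A\<^esub> c)"
    "a \<^bold>\<and>\<^bsub>A\<^esub> b = b \<^bold>\<and>\<^bsub>A\<^esub> a" "a \<^bold>\<or>\<^bsub>A\<^esub> b = b \<^bold>\<or>\<^bsub>A\<^esub> a"
    "a \<^bold>\<and>\<^bsub>A\<^esub> (a \<^bold>\<or>\<^bsub>A\<^esub> b) = a" "a \<^bold>\<or>\<^bsub>A\<^esub> (a \<^bold>\<and>\<^bsub>A\<^esub> b) = a"
    "b \<^bold>\<and>\<^bsub>A\<^esub> (a \<setminus>\<^bsub>A\<^esub> ((a \<otimes>\<^bsub>A\<^esub> b) \<^bold>\<or>\<^bsub>A\<^esub> c)) = b"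
    "a \<^bold>\<and>\<^bsub>A\<^esub> (((a \<otimes>\<^bsub>A\<^esub> b) \<^bold>\<or>\<^bsub>A\<^esub> c) \<oslash>\<^bsub>A\<^esub> b) = a"
    "(a \<otimes>\<^bsub>A\<^esub> (a \<setminus>\<^bsub>A\<^esub> c)) \<^bold>\<and>\<^bsub>A\<^esub> c = a \<otimes>\<^bsub>A\<^esub> (a \<setminus>\<^bsub>A\<^esub> c)"
    "((c \<oslash>\<^bsub>A\<^esub> b) \<otimes>\<^bsub>A\<^esub> b) \<^bold>\<and>\<^bsub>A\<^esub> c = (c \<oslash>\<^bsub>A\<^esub> b) \<otimes>\<^bsub>A\<^esub> b"
    "(a \<otimes>\<^bsub>A\<^esub> b) \<^bold>\<and>\<^bsub>A\<^esub> (a \<otimes>\<^bsub>A\<^esub> (b \<^bold>\<or>\<^bsub>A\<^esub> c)) = a \<otimes>\<^bsub>A\<^esub> b"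
    "(b \<otimes>\<^bsub>A\<^esub> a) \<^bold>\<and>\<^bsub>A\<^esub> ((b \<^bold>\<or>\<^bsub>A\<^esub> c) \<otimes>\<^bsub>A\<^esub> a) = b \<otimes>\<^bsub>A\<^esub> a"
    if abc: "a \<in> carrier A" "b \<in> carrier A" "c \<in> carrier A" for a b c
  proof -
    note r = rules[OF abc, unfolded val_def]
    show "(a \<otimes>\<^bsub>A\<^esub> b) \<otimes>\<^bsub>A\<^esub> c = a \<otimes>\<^bsub>A\<^esub> (b \<otimes>\<^bsub>A\<^esub> c)"
      using r[of "Mult (Mult ?x ?y) ?z" "Mult ?x (Mult ?y ?z)"]
      by (simp add: monoid.m_assoc rlB rg)
    show "\<one>\<^bsub>A\<^esub> \<otimes>\<^bsub>A\<^esub> a = a"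
      using r[of "Mult Unit ?x" "?x"] by (simp add: monoid.l_one rlB rg)
    show "a \<otimes>\<^bsub>A\<^esub> \<one>\<^bsub>A\<^esub> = a"
      using r[of "Mult ?x Unit" "?x"] by (simp add: monoid.r_one rlB rg)
    show "a \<otimes>\<^bsub>A\<^esub> a = a"
      using r[of "Mult ?x ?x" "?x"] ch(2) by (simp add: rl_idempotent_def rg)
    show "(a \<^bold>\<and>\<^bsub>A\<^esub> b) \<^bold>\<and>\<^bsub>A\<^esub> c = a \<^bold>\<and>\<^bsub>A\<^esub> (b \<^bold>\<and>\<^bsub>A\<^esub> c)"
      using r[of "Meet (Meet ?x ?y) ?z" "Meet ?x (Meet ?y ?z)"]
      by (simp add: residuated_lattice.meet_assoc[OF ch(1)] rg)
    show "(a \<^bold>\<or>\<^bsub>A\<^esub> b) \<^bold>\<or>\<^bsub>A\<^esub> c = a \<^bold>\<or>\<^bsub>A\<^esub> (b \<^bold>\<or>\<^bsub>A\<^esub> c)"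
      using r[of "Join (Join ?x ?y) ?z" "Join ?x (Join ?y ?z)"]
      by (simp add: residuated_lattice.join_assoc[OF ch(1)] rg)
    show "a \<^bold>\<and>\<^bsub>A\<^esub> b = b \<^bold>\<and>\<^bsub>A\<^esub> a"
      using r[of "Meet ?x ?y" "Meet ?y ?x"]
      by (simp add: residuated_lattice.meet_comm[OF ch(1)] rg)
    show "a \<^bold>\<or>\<^bsub>A\<^esub> b = b \<^bold>\<or>\<^bsub>A\<^esub> a"
      using r[of "Join ?x ?y" "Join ?y ?x"]
      by (simp add: residuated_lattice.join_comm[OF ch(1)] rg)
    show "a \<^bold>\<and>\<^bsub>A\<^esub> (a \<^bold>\<or>\<^bsub>A\<^esub> b) = a"
      using r[of "Meet ?x (Join ?x ?y)" "?x"]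
      by (simp add: residuated_lattice.meet_absorb[OF ch(1)] rg)
    show "a \<^bold>\<or>\<^bsub>A\<^esub> (a \<^bold>\<and>\<^bsub>A\<^esub> b) = a"
      using r[of "Join ?x (Meet ?x ?y)" "?x"]
      by (simp add: residuated_lattice.join_absorb[OF ch(1)] rg)
    show "b \<^bold>\<and>\<^bsub>A\<^esub> (a \<setminus>\<^bsub>A\<^esub> ((a \<otimes>\<^bsub>A\<^esub> b) \<^bold>\<or>\<^bsub>A\<^esub> c)) = b"
      using r[of "Meet ?y (LDiv ?x (Join (Mult ?x ?y) ?z))" "?y"]
      by (simp add: rl_le_def[symmetric] residuated_lattice.ldiv_residual[OF ch(1)]
          residuated_lattice.le_join1[OF ch(1)] rlB rg)
    show "a \<^bold>\<and>\<^bsub>A\<^esub> (((a \<otimes>\<^bsub>A\<^esub> b) \<^bold>\<or>\<^bsub>A\<^esub> c) \<oslash>\<^bsub>A\<^esub> b) = a"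
      using r[of "Meet ?x (RDiv (Join (Mult ?x ?y) ?z) ?y)" "?x"]
      by (simp add: rl_le_def[symmetric] residuated_lattice.rdiv_residual[OF ch(1), symmetric]
          residuated_lattice.le_join1[OF ch(1)] rlB rg)
    show "(a \<otimes>\<^bsub>A\<^esub> (a \<setminus>\<^bsub>A\<^esub> c)) \<^bold>\<and>\<^bsub>A\<^esub> c = a \<otimes>\<^bsub>A\<^esub> (a \<setminus>\<^bsub>A\<^esub> c)"
      using r[of "Meet (Mult ?x (LDiv ?x ?z)) ?z" "Mult ?x (LDiv ?x ?z)"]
      by (simp add: rl_le_def[symmetric] residuated_lattice.ldiv_residual[OF ch(1), symmetric]
          residuated_lattice.le_refl[OF ch(1)] rlB rg)
    show "((c \<oslash>\<^bsub>A\<^esub> b) \<otimes>\<^bsub>A\<^esub> b) \<^bold>\<and>\<^bsub>A\<^esub> c = (c \<oslash>\<^bsub>A\<^esub> b) \<otimes>\<^bsub>A\<^esub> b"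
      using r[of "Meet (Mult (RDiv ?z ?y) ?y) ?z" "Mult (RDiv ?z ?y) ?y"]
      by (simp add: rl_le_def[symmetric] residuated_lattice.rdiv_residual[OF ch(1)]
          residuated_lattice.le_refl[OF ch(1)] rlB rg)
    show "(a \<otimes>\<^bsub>A\<^esub> b) \<^bold>\<and>\<^bsub>A\<^esub> (a \<otimes>\<^bsub>A\<^esub> (b \<^bold>\<or>\<^bsub>A\<^esub> c)) = a \<otimes>\<^bsub>A\<^esub> b"
      using r[of "Meet (Mult ?x ?y) (Mult ?x (Join ?y ?z))" "Mult ?x ?y"]
      by (simp add: rl_le_def[symmetric] residuated_lattice.mult_join[OF ch(1)] rg)
    show "(b \<otimes>\<^bsub>A\<^esub> a) \<^bold>\<and>\<^bsub>A\<^esub> ((b \<^bold>\<or>\<^bsub>A\<^esub> c) \<otimes>\<^bsub>A\<^esub> a) = b \<otimes>\<^bsub>A\<^esub> a"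
      using r[of "Meet (Mult ?y ?x) (Mult (Join ?y ?z) ?x)" "Mult ?y ?x"]
      by (simp add: rl_le_def[symmetric] residuated_lattice.mult_join[OF ch(1)] rg)
  qed

  have trans: "rl_le A a c" if "rl_le A a b" "rl_le A b c"
    "a \<in> carrier A" "b \<in> carrier A" "c \<in> carrier A" for a b c
    using that eqs(5) unfolding rl_le_def by metis
  have join: "a \<^bold>\<or>\<^bsub>A\<^esub> b = b" if "rl_le A a b" "a \<in> carrier A" "b \<in> carrier A" for a b
    using that eqs(7,8,10) unfolding rl_le_def by metis
  have "residuated_lattice A"
  proof
    fix a b c
    assume abc: "a \<in> carrier A" "b \<in> carrier A" "c \<in> carrier A"
    show "rl_le A b (a \<setminus>\<^bsub>A\<^esub> c) \<longleftrightarrow> rl_le A (a \<otimes>\<^bsub>A\<^esub> b) c"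
    proof
      assume "rl_le A b (a \<setminus>\<^bsub>A\<^esub> c)"
      then have "rl_le A (a \<otimes>\<^bsub>A\<^esub> b) (a \<otimes>\<^bsub>A\<^esub> (a \<setminus>\<^bsub>A\<^esub> c))"
        using eqs(15)[of a b "a \<setminus>\<^bsub>A\<^esub> c"] join abc cl by (simp add: rl_le_def)
      then show "rl_le A (a \<otimes>\<^bsub>A\<^esub> b) c"
        using eqs(13)[of a b c] trans abc cl unfolding rl_le_def[symmetric] by meson
    next
      assume "rl_le A (a \<otimes>\<^bsub>A\<^esub> b) c"
      then show "rl_le A b (a \<setminus>\<^bsub>A\<^esub> c)"
        using eqs(11)[of a b c] join abc cl by (simp add: rl_le_def)
    qed
    show "rl_le A (a \<otimes>\<^bsub>A\<^esub> b) c \<longleftrightarrow> rl_le A a (c \<oslash>\<^bsub>A\<^esub> b)"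
    proof
      assume "rl_le A a (c \<oslash>\<^bsub>A\<^esub> b)"
      then have "rl_le A (a \<otimes>\<^bsub>A\<^esub> b) ((c \<oslash>\<^bsub>A\<^esub> b) \<otimes>\<^bsub>A\<^esub> b)"
        using eqs(16)[of b a "c \<oslash>\<^bsub>A\<^esub> b"] join abc cl by (simp add: rl_le_def)
      then show "rl_le A (a \<otimes>\<^bsub>A\<^esub> b) c"
        using eqs(14)[of a b c] trans abc cl unfolding rl_le_def[symmetric] by meson
    next
      assume "rl_le A (a \<otimes>\<^bsub>A\<^esub> b) c"
      then show "rl_le A a (c \<oslash>\<^bsub>A\<^esub> b)"
        using eqs(12)[of a b c] join abc cl by (simp add: rl_le_def)
    qed
  qed (use alg in \<open>auto intro: cl oneA eqs\<close>)
  moreover have "rl_idempotent A"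
    using eqs(4) by (simp add: rl_idempotent_def)
  ultimately show ?thesis ..
qed

text \<open>
  The variety does not depend on the universe over which the generating chains range, as long as
  it is infinite: an equation that fails in some idempotent residuated chain fails in a countable one.
\<close>

lemma idempotent_chains_equations:
  fixes C :: "'b rl"
  assumes inf: "infinite (UNIV :: 'a set)"
    and C: "C \<in> idempotent_chains"
    and valid: "\<And>A :: 'a rl. A \<in> idempotent_chains \<Longrightarrow> rl_satisfies A p"
  shows "rl_satisfies C p"
  unfolding rl_satisfies_def
proof (intro allI impI)
  fix v :: "nat \<Rightarrow> 'b"
  assume v: "range v \<subseteq> carrier C"
  interpret residuated_lattice C using C by (simp add: idempotent_chains_def)
  define S where "S = range (rl_eval C v)"
  have SC: "S \<subseteq> carrier C"
  proof -
    have "rl_eval C v t \<in> carrier C" for t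
      using v by (induction t) (auto simp: cl)
    then show ?thesis by (auto simp: S_def)
  qed
  have clS: "a \<otimes>\<^bsub>C\<^esub> b \<in> S" "a \<^bold>\<and>\<^bsub>C\<^esub> b \<in> S" "a \<^bold>\<or>\<^bsub>C\<^esub> b \<in> S" "a \<setminus>\<^bsub>C\<^esub> b \<in> S" "a \<oslash>\<^bsub>C\<^esub> b \<in> S"
    if ab: "a \<in> S" "b \<in> S" for a b
  proof -
    obtain s t where "a = rl_eval C v s" "b = rl_eval C v t"
      using ab by (auto simp: S_def)
    then show "a \<otimes>\<^bsub>C\<^esub> b \<in> S" "a \<^bold>\<and>\<^bsub>C\<^esub> b \<in> S" "a \<^bold>\<or>\<^bsub>C\<^esub> b \<in> S" "a \<setminus>\<^bsub>C\<^esub> b \<in> S" "a \<oslash>\<^bsub>C\<^esub> b \<in> S"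
      unfolding S_def by (metis rangeI rl_eval.simps)+
  qed
  have oneS: "\<one>\<^bsub>C\<^esub> \<in> S"
    unfolding S_def by (metis rangeI rl_eval.simps(2))
  have "countable (UNIV :: rl_term set)"
    by (rule countableI_type)
  then have "countable S" by (simp add: S_def)
  then obtain h :: "'b \<Rightarrow> nat" where h: "inj_on h S" by (auto simp: countable_def)
  obtain k :: "nat \<Rightarrow> 'a" where k: "inj k"
    using infinite_countable_subset[OF inf] by auto
  define f where "f = k \<circ> h"
  define g where "g = inv_into S f"
  have f: "inj_on f S"
    unfolding f_def by (rule comp_inj_on[OF h]) (rule inj_on_subset[OF k subset_UNIV])
  have gf: "g (f a) = a" if "a \<in> S" for a
    using that f by (simp add: g_def)
  define D :: "'a rl" where
    "D = \<lparr>carrier = f ` S, monoid.mult = (\<lambda>x y. f (g x \<otimes>\<^bsub>C\<^esub> g y)), one = f \<one>\<^bsub>C\<^esub>,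
      rl_meet = (\<lambda>x y. f (g x \<^bold>\<and>\<^bsub>C\<^esub> g y)), rl_join = (\<lambda>x y. f (g x \<^bold>\<or>\<^bsub>C\<^esub> g y)),
      rl_ldiv = (\<lambda>x y. f (g x \<setminus>\<^bsub>C\<^esub> g y)), rl_rdiv = (\<lambda>x y. f (g x \<oslash>\<^bsub>C\<^esub> g y))\<rparr>"
  have le: "rl_le D (f a) (f b) \<longleftrightarrow> rl_le C a b" if "a \<in> S" "b \<in> S" for a b
    using that f by (simp add: rl_le_def D_def gf clS inj_on_eq_iff)
  have DS: "carrier D = f ` S" by (simp add: D_def)
  have alg: "rl_algebra D"
    by (auto simp: rl_algebra_def rl_subuniverse_def D_def gf clS oneS)
  have op: "f a \<otimes>\<^bsub>D\<^esub> f b = f (a \<otimes>\<^bsub>C\<^esub> b)" "f a \<^bold>\<and>\<^bsub>D\<^esub> f b = f (a \<^bold>\<and>\<^bsub>C\<^esub> b)"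
    "f a \<^bold>\<or>\<^bsub>D\<^esub> f b = f (a \<^bold>\<or>\<^bsub>C\<^esub> b)" "f a \<setminus>\<^bsub>D\<^esub> f b = f (a \<setminus>\<^bsub>C\<^esub> b)" "f a \<oslash>\<^bsub>D\<^esub> f b = f (a \<oslash>\<^bsub>C\<^esub> b)"
    if "a \<in> S" "b \<in> S" for a b
    using that by (simp_all add: D_def gf)
  have one: "\<one>\<^bsub>D\<^esub> = f \<one>\<^bsub>C\<^esub>" by (simp add: D_def)
  note inC = subsetD[OF SC]
  have "residuated_lattice D"
    by unfold_locales
      (use alg in \<open>auto simp: DS op one clS oneS le inC m_assoc meet_assoc join_assoc meet_absorb
        join_absorb ldiv_residual rdiv_residual
        intro!: arg_cong[where f = f] intro: meet_comm[OF inC inC] join_comm[OF inC inC]\<close>)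
  moreover have "rl_idempotent D" "rl_totally_ordered D"
    using C SC by (auto simp: idempotent_chains_def rl_idempotent_def rl_totally_ordered_def DS op le)
  ultimately have "rl_satisfies D p"
    using valid by (simp add: idempotent_chains_def)
  moreover have vS: "v n \<in> S" for n
    unfolding S_def by (metis rangeI rl_eval.simps(1))
  ultimately have "rl_eval D (f \<circ> v) (fst p) = rl_eval D (f \<circ> v) (snd p)"
    unfolding rl_satisfies_def by (auto simp: DS image_subset_iff elim!: allE[of _ "f \<circ> v"])
  moreover have ev: "rl_eval C v t \<in> S" for t
    by (simp add: S_def)
  moreover have "rl_eval D (f \<circ> v) t = f (rl_eval C v t)" for t
    by (induction t) (auto simp: op one ev)
  ultimately show "rl_eval C v (fst p) = rl_eval C v (snd p)"
    using f by (simp add: inj_on_eq_iff)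
qed

end

theory Submission
  imports Defs
begin

text \<open>
  On the integers let \<open>x \<cdot> y\<close> be whichever of \<open>x\<close>, \<open>y\<close> has the larger absolute value, and \<open>x\<close> if
  these agree. With the usual order and unit \<open>0\<close> this is an idempotent residuated chain: it is
  an ordinal sum of the left-zero bands \<open>{-n, n}\<close>. Writing \<open>x \<setminus> z\<close>
  and \<open>z \<oslash> x\<close> for its residuals, \<open>0 \<oslash> 1 = -1\<close>, and \<open>n \<setminus> 0 = -(n + 1)\<close>,
  \<open>(-n) \<setminus> 0 = n\<close> for \<open>n > 0\<close>, so the single generator \<open>1\<close> yields all integers.
\<close>

definition abs_chain :: "int rl" where
  "abs_chain = \<lparr>carrier = UNIV, monoid.mult = (\<lambda>x y. if \<bar>y\<bar> \<le> \<bar>x\<bar> then x else y), one = 0,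
    rl_meet = min, rl_join = max,
    rl_ldiv = (\<lambda>x y. if x \<le> y then max \<bar>x\<bar> y else min y (- \<bar>x\<bar> - 1)),
    rl_rdiv = (\<lambda>y x. if x \<le> y then max (\<bar>x\<bar> - 1) y else min y (- \<bar>x\<bar>))\<rparr>"

lemma rl_le_abs_chain: "rl_le abs_chain x y \<longleftrightarrow> x \<le> y"
  by (simp add: rl_le_def abs_chain_def min_def)

text \<open>As \<open>z\<close> varies, the product of \<open>x\<close> and \<open>z\<close> stays
  \<open>x\<close> while \<open>z\<close> is small in absolute value and is \<open>z\<close> beyond
  that, which gives the case split on \<open>x \<le> y\<close> in both residuals. Ties go to the
  left factor, so the bounds in the two divisions differ by one.\<close>

lemma residuated_lattice_abs_chain: "residuated_lattice abs_chain"
proof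
  show "rl_algebra abs_chain"
    by (simp add: rl_algebra_def rl_subuniverse_def abs_chain_def)
qed (auto simp: rl_le_def abs_chain_def min_def max_def abs_if split: if_splits)

lemma abs_chain_idempotent_chain: "abs_chain \<in> idempotent_chains"
  by (auto simp: idempotent_chains_def residuated_lattice_abs_chain rl_idempotent_def
      rl_totally_ordered_def rl_le_abs_chain) (simp add: abs_chain_def)

lemma abs_chain_subuniverse_UNIV:
  assumes "rl_subuniverse abs_chain S" and "1 \<in> S"
  shows "S = UNIV"
proof -
  have zero: "0 \<in> S"
    using assms(1) by (simp add: rl_subuniverse_def abs_chain_def)
  have neg: "x \<setminus>\<^bsub>abs_chain\<^esub> 0 \<in> S" "0 \<oslash>\<^bsub>abs_chain\<^esub> x \<in> S" if "x \<in> S" for x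
    using assms(1) that by (auto simp: rl_subuniverse_def abs_chain_def)
  \<comment> \<open>The shift by one makes \<open>n\<close> run over the nonzero absolute values;
    \<open>zero\<close> covers the unit.\<close>
  have pair: "int n + 1 \<in> S \<and> - int n - 1 \<in> S" for n
  proof (induction n)
    case 0
    \<comment> \<open>Right division is needed here: \<open>1 \<setminus> 0\<close> is already -2
      and would skip -1.\<close>
    then show ?case using assms(2) neg(2)[of 1] by (simp add: abs_chain_def)
  next
    case (Suc n)
    have "- int (Suc n) - 1 \<in> S"
      using neg(1)[of "int n + 1"] Suc by (simp add: abs_chain_def)
    with neg(1)[OF this] show ?case
      by (simp add: abs_chain_def add.commute)
  qed
  have "x \<in> S" for x
    using pair[of "nat (\<bar>x\<bar> - 1)"] zero by (cases x "0::int" rule: linorder_cases) auto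
  then show ?thesis by auto
qed

text \<open>An isomorphic copy of \<open>C\<close> along an injection \<open>f\<close>, used to move
  the integer chain into the type over which the variety is formed. Off the image of
  \<open>f\<close> the operations take arbitrary values.\<close>

definition rl_transport :: "('b \<Rightarrow> 'a) \<Rightarrow> 'b rl \<Rightarrow> 'a rl" where
  "rl_transport f C = (let g = inv_into (carrier C) f in
    \<lparr>carrier = f ` carrier C, monoid.mult = (\<lambda>x y. f (g x \<otimes>\<^bsub>C\<^esub> g y)), one = f \<one>\<^bsub>C\<^esub>,
      rl_meet = (\<lambda>x y. f (g x \<^bold>\<and>\<^bsub>C\<^esub> g y)), rl_join = (\<lambda>x y. f (g x \<^bold>\<or>\<^bsub>C\<^esub> g y)),
      rl_ldiv = (\<lambda>x y. f (g x \<setminus>\<^bsub>C\<^esub> g y)), rl_rdiv = (\<lambda>x y. f (g x \<oslash>\<^bsub>C\<^esub> g y))\<rparr>)"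

lemma carrier_rl_transport: "carrier (rl_transport f C) = f ` carrier C"
  by (simp add: rl_transport_def Let_def)

lemma one_rl_transport: "\<one>\<^bsub>rl_transport f C\<^esub> = f \<one>\<^bsub>C\<^esub>"
  by (simp add: rl_transport_def Let_def)

lemma rl_transport_op:
  assumes "inj_on f (carrier C)" "a \<in> carrier C" "b \<in> carrier C"
  shows "f a \<otimes>\<^bsub>rl_transport f C\<^esub> f b = f (a \<otimes>\<^bsub>C\<^esub> b)"
    "f a \<^bold>\<and>\<^bsub>rl_transport f C\<^esub> f b = f (a \<^bold>\<and>\<^bsub>C\<^esub> b)"
    "f a \<^bold>\<or>\<^bsub>rl_transport f C\<^esub> f b = f (a \<^bold>\<or>\<^bsub>C\<^esub> b)"
    "f a \<setminus>\<^bsub>rl_transport f C\<^esub> f b = f (a \<setminus>\<^bsub>C\<^esub> b)"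
    "f a \<oslash>\<^bsub>rl_transport f C\<^esub> f b = f (a \<oslash>\<^bsub>C\<^esub> b)"
  using assms by (simp_all add: rl_transport_def Let_def)

lemma rl_transport_idempotent_chain:
  assumes C: "C \<in> idempotent_chains" and f: "inj_on f (carrier C)"
  shows "rl_transport f C \<in> idempotent_chains"
proof -
  interpret residuated_lattice C using C by (simp add: idempotent_chains_def)
  note tr = carrier_rl_transport one_rl_transport rl_transport_op[OF f]
  have le: "rl_le (rl_transport f C) (f a) (f b) \<longleftrightarrow> rl_le C a b"
    if "a \<in> carrier C" "b \<in> carrier C" for a b
    using that f by (simp add: rl_le_def tr cl inj_on_eq_iff)
  have alg: "rl_algebra (rl_transport f C)"
    by (auto simp: rl_algebra_def rl_subuniverse_def tr cl)
  have "residuated_lattice (rl_transport f C)"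
    by unfold_locales
      (use alg in \<open>auto simp: tr cl le m_assoc meet_assoc join_assoc meet_absorb
        join_absorb ldiv_residual rdiv_residual
        intro!: arg_cong[where f = f] intro: meet_comm join_comm\<close>)
  moreover have "rl_idempotent (rl_transport f C)" "rl_totally_ordered (rl_transport f C)"
    using C by (auto simp: idempotent_chains_def rl_idempotent_def rl_totally_ordered_def tr le)
  ultimately show ?thesis by (simp add: idempotent_chains_def)
qed

text \<open>Preimages of subalgebras under a homomorphism are subalgebras; this lets generation in
  the copy be checked in \<open>C\<close>.\<close>

lemma rl_subuniverse_transport_vimage:
  assumes C: "rl_algebra C" and f: "inj_on f (carrier C)"
    and S: "rl_subuniverse (rl_transport f C) S"
  shows "rl_subuniverse C (carrier C \<inter> f -` S)"
proof -
  have "\<one>\<^bsub>C\<^esub> \<in> carrier C"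
    using C by (simp add: rl_algebra_def rl_subuniverse_def)
  moreover have "f (a \<otimes>\<^bsub>C\<^esub> b) \<in> S" "f (a \<^bold>\<and>\<^bsub>C\<^esub> b) \<in> S" "f (a \<^bold>\<or>\<^bsub>C\<^esub> b) \<in> S"
    "f (a \<setminus>\<^bsub>C\<^esub> b) \<in> S" "f (a \<oslash>\<^bsub>C\<^esub> b) \<in> S"
    if "f a \<in> S" "f b \<in> S" and ab: "a \<in> carrier C" "b \<in> carrier C" for a b
    unfolding rl_transport_op[OF f ab, symmetric] using S that by (auto simp: rl_subuniverse_def)
  moreover have "f \<one>\<^bsub>C\<^esub> \<in> S"
    using S by (simp add: rl_subuniverse_def one_rl_transport)
  ultimately show ?thesis
    by (simp add: rl_subuniverse_def rl_algebra_closed[OF C])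
qed

lemma rl_transport_abs_chain_finitely_generated:
  assumes f: "inj f"
  shows "rl_finitely_generated (rl_transport f abs_chain)" (is "rl_finitely_generated ?D")
proof -
  have alg: "rl_algebra abs_chain" "rl_algebra ?D"
    using abs_chain_idempotent_chain rl_transport_idempotent_chain[of abs_chain f] f
    by (auto simp: idempotent_chains_def abs_chain_def intro: residuated_lattice.algebra)
  have car: "carrier ?D = range f"
    by (simp add: carrier_rl_transport abs_chain_def)
  have "range f \<subseteq> S" if S: "rl_subuniverse ?D S" "{f 1} \<subseteq> S" for S
  proof -
    have "rl_subuniverse abs_chain (f -` S)"
      using rl_subuniverse_transport_vimage[OF alg(1) _ S(1)] f by (simp add: abs_chain_def)
    then have "f -` S = UNIV"
      using S(2) by (intro abs_chain_subuniverse_UNIV) auto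
    then show ?thesis by auto
  qed
  \<comment> \<open>For the other inclusion, the carrier is itself one of the subuniverses being
    intersected.\<close>
  then have "rl_generated ?D {f 1} = carrier ?D"
    using alg(2) unfolding rl_generated_def rl_algebra_def car by blast
  then show ?thesis
    unfolding rl_finitely_generated_def car by (intro exI[of _ "{f 1}"]) auto
qed

theorem proposition4p6:
  assumes "infinite (UNIV :: 'a set)"
  shows "\<not> locally_finite (semilinear_idempotent_rl :: 'a rl set)"
proof -
  \<comment> \<open>The infinite universe contains a copy of the naturals, hence of the countable
    set of integers.\<close>
  obtain k :: "nat \<Rightarrow> 'a" where "inj k"
    using infinite_countable_subset[OF assms] by auto
  then have f: "inj (k \<circ> to_nat :: int \<Rightarrow> 'a)" (is "inj ?f")
    by (intro inj_compose) simp_all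
  let ?D = "rl_transport ?f abs_chain"
  have "?D \<in> idempotent_chains"
    using f by (intro rl_transport_idempotent_chain abs_chain_idempotent_chain)
      (simp add: abs_chain_def)
  then have "?D \<in> semilinear_idempotent_rl"
    by (auto simp: semilinear_idempotent_rl_def variety_generated_by_def)
  moreover have "infinite (carrier ?D)"
    using finite_imageD[of ?f UNIV] f by (auto simp: carrier_rl_transport abs_chain_def infinite_UNIV_int)
  ultimately show ?thesis
    using rl_transport_abs_chain_finitely_generated[OF f] by (auto simp: locally_finite_def)
qed

end
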